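(* For all positive integers $n$, $m$ and $s$, $$N(SU(n),m,s)=\frac{1}{m}\sum_{d\mid \gcd(n,m)}\ \sum_{j\ge 0}\phi(d)\binom{n/d+m/d-j-1}{n/d-j}\binom{m/d}{j}\binom{jd}{s}(-1)^{j+s}.$$
   Context: $SU(n)$ is the group of $n\times n$ complex unitary matrices of determinant $1$. $N(SU(n),m,s)$ denotes the number of conjugacy classes of $SU(n)$ (under conjugation by elements of $SU(n)$) consisting of elements $x$ with $x^m=1$ that have exactly $s$ distinct eigenvalues. $\phi$ is Euler's totient function. Binomial coefficients $\binom{a}{b}$ with $b<0$ or $b>a\ge 0$ are $0$ (so the sum over $j$ is finite). *)

theory Defs
  imports
    "Jordan_Normal_Form.Schur_Decomposition"
    "Jordan_Normal_Form.Spectral_Radius"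
    "HOL-Algebra.Group_Action"
    "HOL-Number_Theory.Totient"
begin

definition unitary_mat :: "complex mat \<Rightarrow> bool" where
  "unitary_mat A \<longleftrightarrow>
     square_mat A \<and> inverts_mat A (mat_adjoint A) \<and> inverts_mat (mat_adjoint A) A"

definition SU :: "nat \<Rightarrow> complex mat monoid" where
  "SU n = \<lparr>carrier = {A \<in> carrier_mat n n. unitary_mat A \<and> det A = 1},
           mult = (*), one = 1\<^sub>m n\<rparr>"

definition conjugacy_classes :: "('a, 'b) monoid_scheme \<Rightarrow> 'a set set" where
  "conjugacy_classes G =
     orbits G (carrier G) (\<lambda>g. \<lambda>x \<in> carrier G. g \<otimes>\<^bsub>G\<^esub> x \<otimes>\<^bsub>G\<^esub> inv\<^bsub>G\<^esub> g)"

definition SU_classes :: "nat \<Rightarrow> nat \<Rightarrow> nat \<Rightarrow> complex mat set set" where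
  "SU_classes n m s =
     {C \<in> conjugacy_classes (SU n).
        \<forall>x \<in> C. x [^]\<^bsub>SU n\<^esub> m = \<one>\<^bsub>SU n\<^esub> \<and> card (spectrum x) = s}"

definition N_SU :: "nat \<Rightarrow> nat \<Rightarrow> nat \<Rightarrow> nat" where
  "N_SU n m s = card (SU_classes n m s)"

(* Binomial coefficient with integer arguments, equal to 0 when the lower index is negative
   or exceeds the upper one.  In particular it is not the generalised binomial coefficient
   at negative upper index. *)
definition int_binomial :: "int \<Rightarrow> int \<Rightarrow> nat" where
  "int_binomial a b = (if 0 \<le> b \<and> b \<le> a then nat a choose nat b else 0)"

end

theory Submission
  imports Defs "HOL-Computational_Algebra.Computational_Algebra"
begin

text \<open>
  A unitary matrix is diagonalised by a unitary matrix, which can be rescaled to determinant 1, and the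
  diagonal entries may be listed in any prescribed order.  Hence the classes to be counted
  correspond to the multisets of \<open>n\<close> complex \<open>m\<close>-th roots of unity with product 1 and \<open>s\<close> distinct
  elements.  Mark the number of distinct elements by \<open>y\<close> and detect the product by averaging over the
  characters \<open>z \<mapsto> z ^ t\<close> of the group of \<open>m\<close>-th roots of unity.  If \<open>z \<mapsto> z ^ t\<close> has order \<open>d\<close>, the
  generating function in the size of the multiset is
  \<open>(\<Prod>z. (1 - (1 - y) z\<^sup>t X) / (1 - z\<^sup>t X)) = ((1 - (1 - y)\<^sup>d X\<^sup>d) / (1 - X\<^sup>d))\<^bsup>m/d\<^esup>\<close>,
  and there are \<open>totient d\<close> such \<open>t\<close>.
\<close>

unbundle no fps_syntax

section \<open>Unitary matrices\<close>

lemma mat_adjoint_index [simp]: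
  "i < dim_col A \<Longrightarrow> j < dim_row A \<Longrightarrow> mat_adjoint A $$ (i, j) = conjugate (A $$ (j, i))"
  unfolding mat_adjoint_def by (simp add: mat_of_rows_def)

lemma mat_adjoint_dim [simp]:
  "dim_row (mat_adjoint A) = dim_col A" "dim_col (mat_adjoint A) = dim_row A"
  unfolding mat_adjoint_def by auto

lemma mat_adjoint_carrier [simp]:
  "A \<in> carrier_mat n k \<Longrightarrow> mat_adjoint A \<in> carrier_mat k n"
  by auto

lemma mat_adjoint_mult:
  assumes "A \<in> carrier_mat n k" "B \<in> carrier_mat k l"
  shows "mat_adjoint (A * B) = mat_adjoint B * mat_adjoint A"
  using assms
  by (intro eq_matI)
     (auto simp: scalar_prod_def sum_conjugate conjugate_dist_mul mult.commute intro!: sum.cong)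

lemma mat_adjoint_adjoint [simp]: "mat_adjoint (mat_adjoint A) = A"
  by (intro eq_matI) auto

lemma mat_adjoint_smult: "mat_adjoint (c \<cdot>\<^sub>m A) = conjugate c \<cdot>\<^sub>m mat_adjoint A"
  by (intro eq_matI) (auto simp: conjugate_dist_mul)

lemma mat_adjoint_mat_diag:
  "mat_adjoint (mat_diag n f) = mat_diag n (\<lambda>i. conjugate (f i))"
  by (intro eq_matI) (auto simp: mat_diag_def)

text \<open>For square matrices a one-sided inverse is two-sided, so checking one product
  suffices.\<close>

lemma unitary_mat_iff:
  assumes "A \<in> carrier_mat n n"
  shows "unitary_mat A \<longleftrightarrow> mat_adjoint A * A = 1\<^sub>m n"
  using assms mat_mult_left_right_inverse[OF mat_adjoint_carrier[OF assms] assms]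
  by (auto simp: unitary_mat_def inverts_mat_def)

lemma unitary_matD:
  assumes "A \<in> carrier_mat n n" "unitary_mat A"
  shows "mat_adjoint A * A = 1\<^sub>m n" "A * mat_adjoint A = 1\<^sub>m n"
  using assms by (auto simp: unitary_mat_def inverts_mat_def)

lemma unitary_mat_adjoint:
  assumes "A \<in> carrier_mat n n" "unitary_mat A"
  shows "unitary_mat (mat_adjoint A)"
  using assms by (auto simp: unitary_mat_def inverts_mat_def)

lemma mult_assoc_cancel:
  fixes A :: "'a :: semiring_1 mat"
  assumes "P \<in> carrier_mat n n" "Q \<in> carrier_mat n n" "A \<in> carrier_mat n n" "P * Q = 1\<^sub>m n"
  shows "P * (Q * A) = A"
  using assms assoc_mult_mat[OF assms(1,2,3)] by simp

lemma unitary_mat_mult: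
  assumes A: "A \<in> carrier_mat n n" "unitary_mat A" and B: "B \<in> carrier_mat n n" "unitary_mat B"
  shows "unitary_mat (A * B)"
proof -
  have "mat_adjoint (A * B) * (A * B) = mat_adjoint B * (mat_adjoint A * (A * B))"
    using A(1) B(1) by (simp add: mat_adjoint_mult[of _ n n _ n] assoc_mult_mat[of _ n n _ n _ n])
  also have "\<dots> = 1\<^sub>m n"
    using A B by (simp add: mult_assoc_cancel[of _ n] unitary_matD)
  finally show ?thesis
    using A(1) B(1) by (simp add: unitary_mat_iff[of _ n])
qed

lemma smult_smult_mat: "a \<cdot>\<^sub>m (b \<cdot>\<^sub>m A) = (a * b :: 'a :: semigroup_mult) \<cdot>\<^sub>m A"
  by (intro eq_matI) (auto simp: mult.assoc)

lemma unitary_mat_smult: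
  assumes "A \<in> carrier_mat n n" "unitary_mat A" "cnj c * c = 1"
  shows "unitary_mat (c \<cdot>\<^sub>m A)"
proof -
  have A': "mat_adjoint A \<in> carrier_mat n n" using assms(1) by simp
  have "mat_adjoint (c \<cdot>\<^sub>m A) * (c \<cdot>\<^sub>m A) = cnj c \<cdot>\<^sub>m (mat_adjoint A * (c \<cdot>\<^sub>m A))"
    using A' assms(1) by (simp add: mat_adjoint_smult mult_smult_assoc_mat[of _ n n _ n])
  also have "\<dots> = (cnj c * c) \<cdot>\<^sub>m (mat_adjoint A * A)"
    using A' assms(1) by (simp add: mult_smult_distrib[of _ n n _ n] smult_smult_mat)
  also have "\<dots> = 1\<^sub>m n"
    unfolding assms(3) unitary_matD(1)[OF assms(1,2)] by (intro eq_matI) auto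
  finally show ?thesis using assms(1) by (simp add: unitary_mat_iff[of _ n])
qed

lemma det_adjoint_unitary:
  assumes "A \<in> carrier_mat n n" "unitary_mat A"
  shows "det (mat_adjoint A) * det A = 1"
  using det_mult[OF mat_adjoint_carrier[OF assms(1)] assms(1)] assms by (simp add: unitary_matD)

lemma norm_det_unitary:
  assumes "A \<in> carrier_mat n n" "unitary_mat A"
  shows "norm (det A) = 1"
proof -
  \<comment> \<open>Conjugation is a ring homomorphism and so commutes with \<open>det\<close>;
    hence the adjoint has determinant \<open>cnj (det A)\<close>.\<close>
  interpret cnj: comm_ring_hom cnj by unfold_locales auto
  have "mat_adjoint A = map_mat cnj (transpose_mat A)"
    by (intro eq_matI) auto
  hence "det (mat_adjoint A) = cnj (det A)"
    using cnj.hom_det[of "transpose_mat A"] det_transpose[OF assms(1)] by simp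
  hence "complex_of_real ((norm (det A))\<^sup>2) = 1"
    using det_adjoint_unitary[OF assms] by (simp only: complex_norm_square mult.commute)
  hence "(norm (det A))\<^sup>2 = 1" by (simp only: of_real_eq_1_iff)
  thus ?thesis using norm_ge_zero[of "det A"] by (auto simp: power2_eq_1_iff simp del: norm_ge_zero)
qed

section \<open>Unitary diagonalisation\<close>

definition diag_list :: "'a :: zero list \<Rightarrow> 'a mat" where
  "diag_list xs = mat_diag (length xs) ((!) xs)"

lemma diag_list_carrier [simp]: "diag_list xs \<in> carrier_mat (length xs) (length xs)"
  by (simp add: diag_list_def)

lemma diag_list_upper_triangular: "upper_triangular (diag_list xs)"
  by (auto simp: diag_list_def mat_diag_def)

lemma diag_mat_diag_list [simp]: "diag_mat (diag_list xs) = xs"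
  by (intro nth_equalityI) (auto simp: diag_mat_def diag_list_def mat_diag_def)

lemma char_poly_diag_list: "char_poly (diag_list xs) = (\<Prod>x\<leftarrow>xs. [:- x, 1:])"
  using char_poly_upper_triangular[OF diag_list_carrier diag_list_upper_triangular, of xs] by simp

lemma det_diag_list: "det (diag_list xs) = prod_list xs"
  using det_upper_triangular[OF diag_list_upper_triangular diag_list_carrier, of xs] by simp

text \<open>The characteristic polynomial thus remembers the eigenvalues with multiplicity and
  forgets only their order; this later separates the conjugacy classes.\<close>

lemma proots_prod_linear:
  fixes xs :: "'a :: idom list"
  shows "proots (\<Prod>x\<leftarrow>xs. [:- x, 1:]) = mset xs"
proof (induction xs)
  case (Cons x xs)
  have "(\<Prod>x\<leftarrow>xs. [:- x, 1:]) \<noteq> 0"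
    by (auto simp: prod_list_zero_iff)
  with Cons show ?case by (simp add: proots_mult del: mult_pCons_left)
qed auto

text \<open>The block-diagonal sum of a scalar and a matrix: the shape reached after splitting off
  one eigenvector, and the recursive shape of \<open>diag_list\<close>.\<close>

definition corner :: "'a :: zero \<Rightarrow> 'a mat \<Rightarrow> 'a mat" where
  "corner c D = four_block_mat (mat 1 1 (\<lambda>_. c)) (0\<^sub>m 1 (dim_col D)) (0\<^sub>m (dim_row D) 1) D"

lemma corner_carrier [simp]:
  "D \<in> carrier_mat k k \<Longrightarrow> corner c D \<in> carrier_mat (Suc k) (Suc k)"
  by (auto simp: corner_def)

lemma corner_mult:
  fixes c c' :: "'a :: semiring_0"
  assumes "D \<in> carrier_mat k k" "D' \<in> carrier_mat k k"
  shows "corner c D * corner c' D' = corner (c * c') (D * D')"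
proof -
  have "mat 1 1 (\<lambda>_. c) * mat 1 1 (\<lambda>_. c') = mat 1 1 (\<lambda>_. c * c')"
    by (intro eq_matI) (auto simp: scalar_prod_def)
  with assms show ?thesis
    unfolding corner_def
    by (subst mult_four_block_mat[of _ 1 1 _ k _ k _ _ 1 _ k]) auto
qed

lemma mat_adjoint_corner: "mat_adjoint (corner c D) = corner (conjugate c) (mat_adjoint D)"
  by (intro eq_matI) (auto simp: corner_def)

lemma corner_inject:
  assumes "D \<in> carrier_mat k k" "D' \<in> carrier_mat k k"
  shows "corner c D = corner c' D' \<longleftrightarrow> c = c' \<and> D = D'"
proof safe
  assume eq: "corner c D = corner c' D'"
  show "c = c'"
    using arg_cong[OF eq, of "\<lambda>A. A $$ (0, 0)"] assms by (simp add: corner_def)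
  show "D = D'"
  proof (intro eq_matI)
    fix i j assume "i < dim_row D'" "j < dim_col D'"
    thus "D $$ (i, j) = D' $$ (i, j)"
      using arg_cong[OF eq, of "\<lambda>A. A $$ (Suc i, Suc j)"] assms by (simp add: corner_def)
  qed (use assms in auto)
qed

lemma corner_one: "corner 1 (1\<^sub>m k) = 1\<^sub>m (Suc k)"
  by (intro eq_matI) (auto simp: corner_def)

lemma diag_list_Cons: "diag_list (x # xs) = corner x (diag_list xs)"
  by (intro eq_matI) (auto simp: corner_def diag_list_def mat_diag_def nth_Cons')

text \<open>Adjoints and products act blockwise and the identity is itself a \<open>corner\<close>,
  so the equation expressing unitarity splits into its two diagonal blocks.\<close>

lemma unitary_corner_iff:
  assumes "D \<in> carrier_mat k k"
  shows "unitary_mat (corner c D) \<longleftrightarrow> cnj c * c = 1 \<and> unitary_mat D"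
  using assms
  by (simp add: unitary_mat_iff[of _ "Suc k"] unitary_mat_iff[of _ k] mat_adjoint_corner
      corner_mult[of _ k] corner_inject[OF mult_carrier_mat[OF mat_adjoint_carrier] one_carrier_mat, of D k k]
      flip: corner_one)

lemma char_poly_corner:
  assumes "D \<in> carrier_mat k k"
  shows "char_poly (corner c D) = [:- c, 1:] * char_poly D"
proof -
  have "char_poly (mat 1 1 (\<lambda>_. c)) = [:- c, 1:]"
    by (simp add: char_poly_defs det_def sign_def)
  thus ?thesis
    using assms char_poly_four_block_zeros_col[of "mat 1 1 (\<lambda>_. c)" "0\<^sub>m 1 k" k D]
    by (simp add: corner_def)
qed

text \<open>The first row vanishes off the diagonal because it has norm 1 and so has its entry \<open>e\<close>.\<close>

lemma unitary_mat_eq_corner: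
  assumes A: "A \<in> carrier_mat (Suc k) (Suc k)" "unitary_mat A"
    and col: "\<And>i. i < Suc k \<Longrightarrow> A $$ (i, 0) = (if i = 0 then e else 0)"
  obtains D where "D \<in> carrier_mat k k" "A = corner e D"
proof
  define D where "D = mat k k (\<lambda>(i, j). A $$ (Suc i, Suc j))"
  show "D \<in> carrier_mat k k" by (simp add: D_def)
  have "1 = (mat_adjoint A * A) $$ (0, 0)"
    using A by (simp add: unitary_matD)
  also have "\<dots> = (\<Sum>i<Suc k. cnj (A $$ (i, 0)) * A $$ (i, 0))"
    using A(1) by (simp add: scalar_prod_def atLeast0LessThan)
  also have "\<dots> = cnj e * e"
    by (simp add: col lessThan_Suc_eq_insert_0 sum.reindex)
  finally have e: "cnj e * e = 1" ..
  have "1 = (A * mat_adjoint A) $$ (0, 0)"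
    using A by (simp add: unitary_matD)
  also have "\<dots> = (\<Sum>j<Suc k. A $$ (0, j) * cnj (A $$ (0, j)))"
    using A(1) by (simp add: scalar_prod_def atLeast0LessThan)
  also have "\<dots> = 1 + (\<Sum>j<k. A $$ (0, Suc j) * cnj (A $$ (0, Suc j)))"
    using e by (simp add: col lessThan_Suc_eq_insert_0 sum.reindex mult.commute)
  finally have "(\<Sum>j<k. complex_of_real ((norm (A $$ (0, Suc j)))\<^sup>2)) = 0"
    by (simp only: complex_norm_square) simp
  hence "(\<Sum>j<k. (norm (A $$ (0, Suc j)))\<^sup>2) = 0"
    by (simp only: of_real_sum[symmetric] of_real_eq_0_iff)
  hence "A $$ (0, Suc j) = 0" if "j < k" for j
    using that by (simp add: sum_nonneg_eq_0_iff)
  thus "A = corner e D"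
    using A(1) col by (intro eq_matI) (auto simp: corner_def D_def less_Suc_eq_0_disj)
qed

text \<open>Complete \<open>v\<close> to a basis, orthogonalise by Gram-Schmidt, which keeps the
  first vector, and normalise the columns; \<open>c\<close> is the inverse of the length of
  \<open>v\<close>.\<close>

lemma unitary_mat_with_first_column:
  fixes v :: "complex vec"
  assumes v: "v \<in> carrier_vec n" "v \<noteq> 0\<^sub>v n"
  obtains W c where "W \<in> carrier_mat n n" "unitary_mat W" "col W 0 = c \<cdot>\<^sub>v v"
proof -
  interpret cof_vec_space n "TYPE(complex)" .
  define ws where "ws = gram_schmidt n (basis_completion v)"
  note bc = basis_completion[OF v]
  have "n \<noteq> 0" using v by auto
  with bc obtain vs where vs: "basis_completion v = v # vs"
    by (cases "basis_completion v") auto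
  from gram_schmidt_result[OF bc(2) bc(4) bc(5) refl, folded ws_def]
  have ws: "set ws \<subseteq> carrier_vec n" "corthogonal ws" "length ws = n"
    by (auto simp: bc(6))
  have hd: "hd ws = v" unfolding ws_def vs using v(1) by simp
  have wsc: "ws ! i \<in> carrier_vec n" if "i < n" for i
    using ws that by auto
  \<comment> \<open>Squared lengths of the Gram-Schmidt vectors, which are orthogonal but not yet
    normalised.\<close>
  define r where "r i = (\<Sum>l<n. (norm (ws ! i $ l))\<^sup>2)" for i
  have prod: "ws ! j \<bullet>c ws ! i = (\<Sum>l<n. cnj (ws ! i $ l) * ws ! j $ l)" if "i < n" "j < n" for i j
    using wsc[OF that(1)] wsc[OF that(2)] by (simp add: scalar_prod_def atLeast0LessThan mult.commute)
  have prod_self: "ws ! i \<bullet>c ws ! i = of_real (r i)" if "i < n" for i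
    unfolding prod[OF that that] r_def of_real_sum
    by (intro sum.cong refl) (simp only: complex_norm_square mult.commute)
  have r: "r i > 0" if "i < n" for i
  proof -
    have "r i \<noteq> 0"
      using corthogonalD[OF ws(2), of i i] that ws(3) prod_self[OF that] by auto
    moreover have "r i \<ge> 0" unfolding r_def by (intro sum_nonneg) auto
    ultimately show ?thesis by simp
  qed
  define W where "W = mat n n (\<lambda>(l, j). of_real (1 / sqrt (r j)) * ws ! j $ l)"
  have W: "W \<in> carrier_mat n n" by (simp add: W_def)
  have "mat_adjoint W * W = 1\<^sub>m n"
  proof (intro eq_matI)
    fix i j assume ij: "i < dim_row (1\<^sub>m n)" "j < dim_col (1\<^sub>m n)"
    hence "(mat_adjoint W * W) $$ (i, j) =
           (\<Sum>l<n. of_real (1 / sqrt (r i)) * of_real (1 / sqrt (r j)) * (cnj (ws ! i $ l) * ws ! j $ l))"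
      using W by (simp add: scalar_prod_def atLeast0LessThan W_def mult_ac)
    also have "\<dots> = of_real (1 / sqrt (r i) * (1 / sqrt (r j))) * (ws ! j \<bullet>c ws ! i)"
      using ij by (simp add: prod sum_distrib_left)
    also have "\<dots> = (1\<^sub>m n :: complex mat) $$ (i, j)"
    proof (cases "i = j")
      case True
      have self: "ws ! j \<bullet>c ws ! j = of_real (r j)"
        using ij prod_self by simp
      have "1 / sqrt (r j) * (1 / sqrt (r j)) * r j = 1"
        using r[of j] ij by (simp add: field_simps)
      thus ?thesis
        using ij by (simp only: True self of_real_mult[symmetric]) simp
    next
      case False
      with ij have "ws ! j \<bullet>c ws ! i = 0"
        using corthogonalD[OF ws(2), of j i] ws(3) by auto
      with False ij show ?thesis by simp
    qed
    finally show "(mat_adjoint W * W) $$ (i, j) = (1\<^sub>m n :: complex mat) $$ (i, j)" .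
  qed (use W in auto)
  hence "unitary_mat W" using W by (simp add: unitary_mat_iff)
  moreover have "col W 0 = of_real (1 / sqrt (r 0)) \<cdot>\<^sub>v v"
  proof -
    have "ws ! 0 = v" using hd ws(3) \<open>n \<noteq> 0\<close> by (metis hd_conv_nth list.size(3))
    thus ?thesis using v(1) \<open>n \<noteq> 0\<close> by (intro eq_vecI) (auto simp: W_def)
  qed
  ultimately show ?thesis using W that by blast
qed

text \<open>Induction on the list of roots: an eigenvector for the head becomes the first column of
  a unitary \<open>W\<close>; conjugating by \<open>W\<close> leaves a block
  \<open>corner e D\<close>, and the tail lists the roots of \<open>D\<close>. Since
  \<open>es\<close> is any ordering of the roots, the diagonal comes out in the prescribed
  order.\<close>

theorem unitary_diagonalization:
  assumes "A \<in> carrier_mat n n" "unitary_mat A" "char_poly A = (\<Prod>e\<leftarrow>es. [:- e, 1:])"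
  shows "\<exists>U \<in> carrier_mat n n. unitary_mat U \<and> A = U * diag_list es * mat_adjoint U"
  using assms
proof (induction es arbitrary: n A)
  case Nil
  hence "n = 0" using degree_monic_char_poly[OF Nil(1)] by simp
  with Nil show ?case
    by (intro bexI[of _ "1\<^sub>m 0"] conjI eq_matI) (auto simp: unitary_mat_iff[of _ 0])
next
  case (Cons e es)
  note A = Cons.prems(1,2)
  have "eigenvalue A e"
    by (simp add: eigenvalue_root_char_poly[OF A(1)] Cons.prems(3))
  then obtain v where v: "v \<in> carrier_vec n" "v \<noteq> 0\<^sub>v n" "A *\<^sub>v v = e \<cdot>\<^sub>v v"
    using A(1) by (auto simp: eigenvalue_def eigenvector_def)
  then obtain k where n: "n = Suc k" by (cases n) auto
  obtain W c where W: "W \<in> carrier_mat n n" "unitary_mat W" "col W 0 = c \<cdot>\<^sub>v v"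
    using unitary_mat_with_first_column[OF v(1,2)] by blast
  define B where "B = mat_adjoint W * A * W"
  have B: "B \<in> carrier_mat n n" "unitary_mat B"
    using A W unfolding B_def by (auto intro!: unitary_mat_mult[of _ n] unitary_mat_adjoint)
  \<comment> \<open>The first column of \<open>W\<close> is an eigenvector of \<open>A\<close>, so
    the first column of \<open>B\<close> is \<open>e\<close> times that of
    \<open>mat_adjoint W * W\<close>, the identity.\<close>
  have "B $$ (i, 0) = (if i = 0 then e else 0)" if "i < Suc k" for i
  proof -
    have "B $$ (i, 0) = (mat_adjoint W * (A * W)) $$ (i, 0)"
      using A W by (simp add: B_def assoc_mult_mat[of _ n n _ n _ n])
    also have "\<dots> = row (mat_adjoint W) i \<bullet> (A *\<^sub>v col W 0)"
      using A(1) W(1) that n by (simp flip: col_mult2[OF A(1) W(1)])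
    also have "A *\<^sub>v col W 0 = e \<cdot>\<^sub>v col W 0"
      using A v by (simp add: W mult_mat_vec[of _ n n] smult_smult_assoc mult.commute)
    also have "row (mat_adjoint W) i \<bullet> (e \<cdot>\<^sub>v col W 0) = e * (mat_adjoint W * W) $$ (i, 0)"
      using W(1) that n by (simp add: scalar_prod_smult_distrib[of _ n])
    also have "\<dots> = (if i = 0 then e else 0)"
      using W that n by (simp add: unitary_matD)
    finally show ?thesis .
  qed
  from unitary_mat_eq_corner[OF B[unfolded n] this] obtain D
    where D: "D \<in> carrier_mat k k" "B = corner e D" by blast
  have "unitary_mat D" using B(2) D by (simp add: unitary_corner_iff)
  have A_eq: "A = W * B * mat_adjoint W"
  proof -
    have "W * B * mat_adjoint W = W * (mat_adjoint W * (A * (W * mat_adjoint W)))"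
      using A W by (simp add: B_def assoc_mult_mat[of _ n n _ n _ n] mult_carrier_mat[of _ n n _ n])
    also have "\<dots> = A"
      using A W by (simp add: unitary_matD mult_assoc_cancel[of _ n])
    finally show ?thesis ..
  qed
  have "similar_mat A B"
    unfolding similar_mat_def
    using similar_mat_witI[OF unitary_matD(2,1)[OF W(1,2)] A_eq A(1) B(1) W(1) mat_adjoint_carrier[OF W(1)]]
    by blast
  from char_poly_similar[OF this]
  have "[:- e, 1:] * char_poly D = [:- e, 1:] * (\<Prod>e\<leftarrow>es. [:- e, 1:])"
    by (simp only: D(2) char_poly_corner[OF D(1)] Cons.prems(3) list.map prod_list.Cons)
  \<comment> \<open>Similarity preserves the characteristic polynomial, and the nonzero factor
    belonging to \<open>e\<close> cancels.\<close>
  hence cp_D: "char_poly D = (\<Prod>e\<leftarrow>es. [:- e, 1:])"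
    by (subst (asm) mult_cancel_left) auto
  from Cons.IH[OF D(1) \<open>unitary_mat D\<close> this] obtain V
    where V: "V \<in> carrier_mat k k" "unitary_mat V" "D = V * diag_list es * mat_adjoint V" by blast
  \<comment> \<open>A priori \<open>diag_list es\<close> has size \<open>length es\<close>;
    comparing degrees in \<open>cp_D\<close> shows that this is \<open>k\<close>.\<close>
  have len: "diag_list es \<in> carrier_mat k k"
    using degree_monic_char_poly[OF D(1)] cp_D degree_linear_factors[of uminus es]
    by (metis diag_list_carrier)
  \<comment> \<open>The diagonaliser \<open>V\<close> of \<open>D\<close> is extended by 1, so that
    it leaves the split-off eigenvector alone.\<close>
  define U where "U = W * corner 1 V"
  have c1V: "corner 1 V \<in> carrier_mat n n" using V n by simp
  have "unitary_mat (corner 1 V)" using V by (simp add: unitary_corner_iff)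
  have "B = corner 1 V * diag_list (e # es) * mat_adjoint (corner 1 V)"
    using V len by (simp add: D diag_list_Cons mat_adjoint_corner corner_mult[of _ k])
  hence "A = U * diag_list (e # es) * mat_adjoint U"
    using W(1) c1V corner_carrier[OF len, of e, folded n]
    by (subst A_eq) (simp add: U_def mat_adjoint_mult[of _ n n _ n] diag_list_Cons
      assoc_mult_mat[of _ n n _ n _ n] mult_carrier_mat[of _ n n _ n])
  moreover have "U \<in> carrier_mat n n" "unitary_mat U"
    unfolding U_def using W c1V \<open>unitary_mat (corner 1 V)\<close> by (auto intro!: unitary_mat_mult[of _ n])
  ultimately show ?case by blast
qed


section \<open>Conjugacy in the special unitary group\<close>

lemma SU_simps [simp]:
  "carrier (SU n) = {A \<in> carrier_mat n n. unitary_mat A \<and> det A = 1}"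
  "A \<otimes>\<^bsub>SU n\<^esub> B = A * B" "\<one>\<^bsub>SU n\<^esub> = 1\<^sub>m n"
  by (simp_all add: SU_def)

lemma mat_adjoint_in_SU:
  assumes "A \<in> carrier (SU n)"
  shows "mat_adjoint A \<in> carrier (SU n)"
  using assms det_adjoint_unitary[of A n] by (auto intro: unitary_mat_adjoint)

lemma group_SU: "group (SU n)"
proof (rule groupI)
  fix A B assume "A \<in> carrier (SU n)" "B \<in> carrier (SU n)"
  thus "A \<otimes>\<^bsub>SU n\<^esub> B \<in> carrier (SU n)"
    by (auto simp: det_mult intro: unitary_mat_mult)
next
  fix A assume "A \<in> carrier (SU n)"
  thus "\<exists>B \<in> carrier (SU n). B \<otimes>\<^bsub>SU n\<^esub> A = \<one>\<^bsub>SU n\<^esub>"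
    using mat_adjoint_in_SU[of A n] by (intro bexI[of _ "mat_adjoint A"]) (auto simp: unitary_matD)
qed (auto simp: unitary_mat_iff[of _ n] assoc_mult_mat)

lemma inv_SU:
  assumes "A \<in> carrier (SU n)"
  shows "inv\<^bsub>SU n\<^esub> A = mat_adjoint A"
  using assms mat_adjoint_in_SU[OF assms]
  by (intro group.inv_equality[OF group_SU]) (auto simp: unitary_matD)

lemma pow_conjugate:
  fixes G (structure)
  assumes "group G" "g \<in> carrier G" "x \<in> carrier G"
  shows "(g \<otimes> x \<otimes> inv g) [^] (k :: nat) = g \<otimes> x [^] k \<otimes> inv g"
proof -
  interpret group G by fact
  show ?thesis
  proof (induction k)
    case (Suc k)
    have "inv g \<otimes> (g \<otimes> (x \<otimes> inv g)) = x \<otimes> inv g"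
      using assms by (simp flip: m_assoc)
    with Suc assms show ?case by (simp add: m_assoc)
  qed (use assms in simp)
qed

lemma diag_list_in_SU:
  assumes "\<And>x. x \<in> set xs \<Longrightarrow> cnj x * x = 1" "prod_list xs = 1"
  shows "diag_list xs \<in> carrier (SU (length xs))"
proof -
  have "mat_adjoint (diag_list xs) * diag_list xs = mat_diag (length xs) (\<lambda>i. cnj (xs ! i) * xs ! i)"
    by (simp add: diag_list_def mat_adjoint_mat_diag)
  also have "\<dots> = 1\<^sub>m (length xs)"
    using assms(1) by (intro eq_matI) (auto simp: mat_diag_def)
  finally show ?thesis
    using assms(2) by (simp add: unitary_mat_iff[OF diag_list_carrier] det_diag_list)
qed

lemma pow_diag_list_SU:
  "diag_list xs [^]\<^bsub>SU (length xs)\<^esub> k = mat_diag (length xs) (\<lambda>i. (xs ! i) ^ k)"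
  by (induction k) (simp_all add: nat_pow_def diag_list_def mult.commute)

lemma pow_diag_list_SU_eq_one_iff:
  "diag_list xs [^]\<^bsub>SU (length xs)\<^esub> k = \<one>\<^bsub>SU (length xs)\<^esub> \<longleftrightarrow> (\<forall>x \<in> set xs. x ^ k = 1)"
proof -
  have "mat_diag n f = 1\<^sub>m n \<longleftrightarrow> (\<forall>i<n. f i = (1 :: complex))" for n f
    by (auto simp: mat_diag_def mat_eq_iff)
  thus ?thesis
    by (simp add: pow_diag_list_SU all_set_conv_all_nth)
qed

text \<open>A scalar of modulus 1 cancels in a conjugation, so the diagonalising unitary
  \<open>U\<close> may be multiplied by an \<open>n\<close>-th root \<open>c\<close> of
  \<open>inverse (det U)\<close> to get determinant 1.\<close>

lemma conjugate_diag_list_SU: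
  assumes "A \<in> carrier (SU n)" "n > 0" "char_poly A = (\<Prod>e\<leftarrow>es. [:- e, 1:])"
  shows "\<exists>g \<in> carrier (SU n). A = g \<otimes>\<^bsub>SU n\<^esub> diag_list es \<otimes>\<^bsub>SU n\<^esub> inv\<^bsub>SU n\<^esub> g"
proof -
  from assms(1) have A: "A \<in> carrier_mat n n" "unitary_mat A" by auto
  obtain U where U: "U \<in> carrier_mat n n" "unitary_mat U" "A = U * diag_list es * mat_adjoint U"
    using unitary_diagonalization[OF A assms(3)] by blast
  have es: "diag_list es \<in> carrier_mat n n"
    using degree_monic_char_poly[OF A(1)] assms(3) degree_linear_factors[of uminus es]
    by (metis diag_list_carrier)
  have "det U \<noteq> 0" using det_adjoint_unitary[OF U(1,2)] by auto
  \<comment> \<open>The root exists because the set of such roots has \<open>n > 0\<close>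
    elements.\<close>
  hence "card {z. z ^ n = inverse (det U)} = n"
    using assms(2) by (intro card_nth_roots) auto
  with assms(2) have "{z. z ^ n = inverse (det U)} \<noteq> {}" by (metis card.empty less_irrefl)
  then obtain c where c: "c ^ n = inverse (det U)" by blast
  \<comment> \<open>The determinant of a unitary matrix has modulus 1, which forces
    \<open>norm c = 1\<close> and keeps the rescaled matrix unitary.\<close>
  have "norm (det U) = 1" using norm_det_unitary[OF U(1,2)] .
  hence "norm c ^ n = 1" using arg_cong[OF c, of norm] by (simp add: norm_power norm_inverse)
  hence "norm c = 1" using assms(2) power_eq_1_iff[of "norm c" n] by simp
  hence cc: "cnj c * c = 1" by (simp add: complex_norm_square[symmetric] mult.commute)
  let ?g = "c \<cdot>\<^sub>m U"
  have g: "?g \<in> carrier (SU n)"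
    using U(1) unitary_mat_smult[OF U(1,2) cc] c \<open>det U \<noteq> 0\<close> by simp
  have UD: "U * diag_list es \<in> carrier_mat n n" and U': "mat_adjoint U \<in> carrier_mat n n"
    using U(1) es by auto
  have "?g * diag_list es * mat_adjoint ?g =
        (c \<cdot>\<^sub>m (U * diag_list es)) * (cnj c \<cdot>\<^sub>m mat_adjoint U)"
    by (simp add: mult_smult_assoc_mat[OF U(1) es] mat_adjoint_smult)
  also have "\<dots> = cnj c \<cdot>\<^sub>m (c \<cdot>\<^sub>m A)"
    by (simp add: mult_smult_distrib[OF smult_carrier_mat[OF UD] U'] mult_smult_assoc_mat[OF UD U'] U(3))
  also have "\<dots> = A"
    unfolding smult_smult_mat cc by (intro eq_matI) auto
  finally have "A = ?g * diag_list es * mat_adjoint ?g" ..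
  thus ?thesis using inv_SU[OF g] by (intro bexI[OF _ g]) simp
qed

section \<open>Conjugacy classes as orbits\<close>

definition conj_class :: "('a, 'b) monoid_scheme \<Rightarrow> 'a \<Rightarrow> 'a set" where
  "conj_class G x = {g \<otimes>\<^bsub>G\<^esub> x \<otimes>\<^bsub>G\<^esub> inv\<^bsub>G\<^esub> g | g. g \<in> carrier G}"

text \<open>The maps in \<open>conjugacy_classes\<close> are restricted to the carrier, but orbits
  are taken only at points of the carrier, where the restriction changes nothing.\<close>

lemma conjugacy_classes_eq: "conjugacy_classes G = conj_class G ` carrier G"
  by (auto simp: conjugacy_classes_def orbits_def orbit_def conj_class_def)

lemma conj_class_refl:
  assumes "group G" "x \<in> carrier G"
  shows "x \<in> conj_class G x"
  using group_action.orbit_refl[OF group.action_by_conjugation[OF assms(1)] assms(2)] assms(2)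
  by (auto simp: orbit_def conj_class_def)

text \<open>Orbits of a group action are equal or disjoint, and \<open>y\<close> lies in
  both.\<close>

lemma conj_class_eqI:
  assumes "group G" "x \<in> carrier G" "y \<in> carrier G" "y \<in> conj_class G x"
  shows "conj_class G y = conj_class G x"
proof -
  have "conj_class G x \<in> conjugacy_classes G" "conj_class G y \<in> conjugacy_classes G"
    using assms by (auto simp: conjugacy_classes_eq)
  from group_action.disjoint_union[OF group.action_by_conjugation[OF assms(1)] this[unfolded conjugacy_classes_def]]
  show ?thesis using assms conj_class_refl[OF assms(1,3)] by auto
qed

lemma char_poly_conj_class_SU:
  assumes "x \<in> carrier (SU n)" "y \<in> conj_class (SU n) x"
  shows "char_poly y = char_poly x"
proof -
  obtain g where g: "g \<in> carrier (SU n)" "y = g * x * mat_adjoint g"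
    using assms(2) inv_SU by (auto simp: conj_class_def)
  have c: "x \<in> carrier_mat n n" "g \<in> carrier_mat n n" "unitary_mat g"
    using g assms(1) by auto
  hence "y \<in> carrier_mat n n" unfolding g(2) by (intro mult_carrier_mat mat_adjoint_carrier)
  hence "similar_mat y x"
    unfolding similar_mat_def
    using similar_mat_witI[OF unitary_matD(2,1)[OF c(2,3)] g(2) _ c(1,2) mat_adjoint_carrier[OF c(2)]]
    by blast
  thus ?thesis by (rule char_poly_similar)
qed

section \<open>Multisets of roots of unity\<close>

text \<open>Factor \<open>X^m - 1\<close> into linear factors over its roots, evaluate at
  \<open>1 / w\<close> and multiply by \<open>w ^ m\<close>.\<close>

lemma prod_one_minus_roots_unity:
  fixes w :: complex
  assumes "m > 0"
  shows "(\<Prod>z | z ^ m = 1. 1 - z * w) = 1 - w ^ m"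
proof (cases "w = 0")
  case True
  with assms show ?thesis by simp
next
  case False
  define p :: "complex poly" where "p = Polynomial.monom 1 m - 1"
  have poly_p: "poly p z = z ^ m - 1" for z
    by (simp add: p_def poly_monom)
  have "degree p = m"
    using assms degree_add_eq_left[of "-1" "Polynomial.monom (1 :: complex) m"]
    by (simp add: p_def degree_monom_eq)
  hence lc: "lead_coeff p = 1"
    using assms by (simp add: p_def)
  \<comment> \<open>A double root \<open>a\<close> would satisfy \<open>m * a^(m-1) = 0\<close>,
    which is impossible because \<open>a ^ m = 1\<close>.\<close>
  have "rsquarefree p"
    unfolding rsquarefree_roots
  proof (intro allI notI)
    fix a assume a: "poly p a = 0 \<and> poly (pderiv p) a = 0"
    hence "a ^ m = 1" by (simp add: poly_p)
    moreover have "of_nat m * a ^ (m - 1) = 0"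
      using a by (simp add: p_def pderiv_diff pderiv_monom poly_monom)
    ultimately show False using assms by (cases m) (auto simp flip: of_nat_Suc)
  qed
  from complex_poly_decompose_rsquarefree[OF this]
  have "p = (\<Prod>z | z ^ m = 1. [:-z, 1:])"
    by (simp add: lc poly_p)
  hence "(1 / w) ^ m - 1 = (\<Prod>z | z ^ m = 1. 1 / w - z)"
    using poly_p[of "1 / w"] by (simp add: poly_prod)
  also have "\<dots> = (\<Prod>z | z ^ m = 1. (1 - z * w) / w)"
    using False by (intro prod.cong) (auto simp: field_simps)
  also have "\<dots> = (\<Prod>z | z ^ m = 1. 1 - z * w) / w ^ m"
    using assms by (simp add: prod_dividef card_roots_unity_eq)
  finally show ?thesis using False by (simp add: field_simps)
qed

lemma power_eq_1_gcd:
  fixes z :: "'a :: field"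
  assumes "z ^ a = 1" "z ^ b = 1" "a > 0"
  shows "z ^ gcd a b = 1"
proof -
  obtain x y where "a * x = b * y + gcd a b"
    using bezout_nat[of a b] assms(3) by auto
  hence "z ^ (a * x) = z ^ (b * y) * z ^ gcd a b"
    by (simp add: power_add)
  thus ?thesis using assms by (simp add: power_mult)
qed

text \<open>If two roots have the same \<open>k\<close>-th power, the order of their quotient
  divides both \<open>k\<close> and \<open>d\<close>, so they agree; an injective self-map of a
  finite set is onto.\<close>

lemma bij_betw_power_roots_unity:
  assumes "d > 0" "coprime k d"
  shows "bij_betw (\<lambda>z :: complex. z ^ k) {z. z ^ d = 1} {z. z ^ d = 1}"
proof -
  have fin: "finite {z :: complex. z ^ d = 1}"
    using assms by (intro finite_roots_unity) auto
  have "inj_on (\<lambda>z :: complex. z ^ k) {z. z ^ d = 1}"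
  proof (rule inj_onI)
    fix x y :: complex
    assume xy: "x \<in> {z. z ^ d = 1}" "y \<in> {z. z ^ d = 1}" "x ^ k = y ^ k"
    have "y \<noteq> 0" using xy(2) assms by (auto simp: power_0_left)
    have "(x / y) ^ d = 1" "(x / y) ^ k = 1"
      using xy \<open>y \<noteq> 0\<close> by (auto simp: power_divide)
    hence "(x / y) ^ gcd d k = 1"
      using assms by (intro power_eq_1_gcd) auto
    moreover have "gcd d k = 1" using assms by (simp add: coprime_iff_gcd_eq_1 gcd.commute)
    ultimately show "x = y" using \<open>y \<noteq> 0\<close> by simp
  qed
  moreover have "(\<lambda>z :: complex. z ^ k) ` {z. z ^ d = 1} \<subseteq> {z. z ^ d = 1}"
    by (auto simp: power_mult [symmetric] mult.commute[of k]) (simp add: power_mult)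
  ultimately show ?thesis
    using endo_inj_surj[OF fin] by (auto simp: bij_betw_def)
qed

text \<open>With \<open>d = m div g\<close> and \<open>k = t div g\<close>, group the roots by
  \<open>c = z ^ g\<close>: each \<open>d\<close>-th root of unity \<open>c\<close> arises from
  \<open>g\<close> values of \<open>z\<close>, and \<open>z ^ t = c ^ k\<close>. As \<open>k\<close>
  is coprime to \<open>d\<close>, the map from \<open>c\<close> to \<open>c ^ k\<close> only
  permutes the factors.\<close>

lemma prod_roots_unity_power:
  fixes h :: "complex \<Rightarrow> 'a :: comm_semiring_1"
  assumes "m > 0" and g: "g = gcd t m"
  shows "(\<Prod>z | z ^ m = 1. h (z ^ t)) = (\<Prod>z | z ^ (m div g) = 1. h z) ^ g"
proof -
  define d where "d = m div g"
  define k where "k = t div g"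
  have "g > 0" using assms by simp
  have m: "m = g * d" and t: "t = g * k"
    using g by (simp_all add: d_def k_def)
  have "d > 0" using assms(1) m by (cases d) auto
  have "coprime k d"
    using div_gcd_coprime[of t m] assms by (simp add: d_def k_def)
  have fin: "finite {z :: complex. z ^ l = 1}" if "l > 0" for l
    using that by (intro finite_roots_unity) auto
  have "(\<Prod>z | z ^ m = 1. h (z ^ t)) = (\<Prod>c | c ^ d = 1. \<Prod>z | z ^ m = 1 \<and> z ^ g = c. h (z ^ t))"
  proof -
    have "(\<lambda>z :: complex. z ^ g) ` {z. z ^ m = 1} \<subseteq> {c. c ^ d = 1}"
      by (auto simp: m power_mult)
    from prod.group[OF fin[OF \<open>m > 0\<close>] fin[OF \<open>d > 0\<close>] this, of "\<lambda>z. h (z ^ t)"]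
    show ?thesis by simp
  qed
  also have "\<dots> = (\<Prod>c | c ^ d = 1. h (c ^ k) ^ g)"
  proof (rule prod.cong[OF refl])
    fix c :: complex assume c: "c \<in> {c. c ^ d = 1}"
    hence "c \<noteq> 0" using \<open>d > 0\<close> by (auto simp: power_0_left)
    have "(\<Prod>z | z ^ m = 1 \<and> z ^ g = c. h (z ^ t)) = (\<Prod>z | z ^ g = c. h (c ^ k))"
      using c by (intro prod.cong) (auto simp: m t power_mult)
    thus "(\<Prod>z | z ^ m = 1 \<and> z ^ g = c. h (z ^ t)) = h (c ^ k) ^ g"
      using card_nth_roots[OF \<open>c \<noteq> 0\<close> \<open>g > 0\<close>] by simp
  qed
  also have "\<dots> = (\<Prod>c | c ^ d = 1. h (c ^ k)) ^ g"
    by (simp add: prod_power_distrib)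
  also have "(\<Prod>c | c ^ d = 1. h (c ^ k)) = (\<Prod>c | c ^ d = 1. h c)"
    by (rule prod.reindex_bij_betw[OF bij_betw_power_roots_unity]) fact+
  finally show ?thesis by (simp add: d_def)
qed

lemma fps_prod_one_minus_roots_unity:
  fixes u :: complex
  assumes "m > 0"
  shows "(\<Prod>z | z ^ m = 1. 1 - fps_const (u * z) * fps_X) = 1 - fps_const (u ^ m) * fps_X ^ m"
proof -
  have "(\<Prod>z | z ^ m = 1. 1 - Polynomial.monom (u * z) 1) = 1 - Polynomial.monom (u ^ m) m"
    (is "?p = ?q")
  \<comment> \<open>The numerical identity holds at every complex \<open>w\<close>, hence between
    polynomials, and from there it passes to power series.\<close>
  proof (rule poly_eq_poly_eq_iff[THEN iffD1], rule ext)
    fix w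
    have "poly ?p w = (\<Prod>z | z ^ m = 1. 1 - z * (u * w))"
      by (simp add: poly_prod poly_monom mult_ac)
    also have "\<dots> = poly ?q w"
      using assms by (simp add: prod_one_minus_roots_unity poly_monom power_mult_distrib)
    finally show "poly ?p w = poly ?q w" .
  qed
  hence "fps_of_poly ?p = fps_of_poly ?q" by simp
  thus ?thesis
    by (simp add: fps_of_poly_prod fps_of_poly_diff fps_of_poly_monom)
qed

lemma fps_nth_one_minus_power:
  fixes v :: "'a :: comm_ring_1"
  shows "fps_nth ((1 - fps_const v * fps_X) ^ g) j = of_nat (g choose j) * (- v) ^ j"
proof -
  have "(1 - fps_const v * fps_X) ^ g = (fps_const (- v) * fps_X + 1) ^ g"
    by (simp flip: fps_const_neg)
  also have "\<dots> = (\<Sum>k\<le>g. fps_const (of_nat (g choose k) * (- v) ^ k) * fps_X ^ k)"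
    unfolding binomial_ring
    by (simp add: power_mult_distrib fps_const_power fps_of_nat [symmetric] mult.assoc flip: fps_const_mult)
  finally show ?thesis
    by (simp add: fps_sum_nth if_distrib[where f = "\<lambda>x. _ * x"] sum.delta cong: if_cong)
       (simp add: binomial_eq_0)
qed

text \<open>The series weights each multiplicity \<open>i\<close> of one root by
  \<open>z ^ i\<close> and has a single factor \<open>y\<close> as soon as the root occurs.
  Multiplying by \<open>1 - z X\<close> telescopes it to a linear polynomial.\<close>

lemma fps_one_minus_mult_marked_geometric:
  fixes y z :: "'a :: comm_ring_1"
  shows "(1 - fps_const z * fps_X) * Abs_fps (\<lambda>i. if i = 0 then 1 else y * z ^ i) =
         1 - fps_const ((1 - y) * z) * fps_X"
proof (rule fps_ext)
  fix i
  show "fps_nth ((1 - fps_const z * fps_X) * Abs_fps (\<lambda>i. if i = 0 then 1 else y * z ^ i)) i =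
        fps_nth (1 - fps_const ((1 - y) * z) * fps_X) i"
  proof (cases i)
    case (Suc k)
    then show ?thesis
      by (cases k) (simp_all add: left_diff_distrib mult.assoc algebra_simps)
  qed (simp add: left_diff_distrib mult.assoc)
qed

text \<open>The left side is the coefficient of \<open>X^n\<close> in a product of marked geometric
  series, one per root, where the exponent chosen in each factor is the multiplicity of that root.
  The product is a power series in \<open>X^d\<close>, whence the case distinction.\<close>

lemma sum_multisets_roots_unity:
  fixes y :: complex
  assumes "m > 0" and g: "g = gcd t m" and d: "d = m div g"
  shows "(\<Sum>X\<in>multisets_of_size {z :: complex. z ^ m = 1} n. y ^ card (set_mset X) * prod_mset X ^ t) =
    (if d dvd n then \<Sum>j\<le>n div d. of_nat (g choose j) * (- 1) ^ j * (1 - y) ^ (d * j) *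
       of_nat ((g + (n div d - j) - 1) choose (n div d - j)) else 0)"
proof -
  have "g > 0" using assms by simp
  have "d > 0" using assms by (simp add: div_greater_zero_iff)
  have fin: "finite {z :: complex. z ^ m = 1}"
    using assms by (intro finite_roots_unity) auto
  define F where "F z = Abs_fps (\<lambda>i. if i = 0 then 1 else y * z ^ i)" for z
  define P where "P = (\<Prod>z | z ^ m = 1. F (z ^ t))"
  define v where "v = (1 - y) ^ d"
  \<comment> \<open>The closed form with \<open>X^d\<close> replaced by \<open>X\<close>, so that
    \<open>P\<close> is \<open>Q\<close> composed with \<open>X^d\<close>. The explicit
    \<open>fps_const 1\<close> matches the shape of the negative binomial expansion.\<close>
  define Q :: "complex fps" where
    "Q = (1 - fps_const v * fps_X) ^ g * inverse ((1 - fps_const 1 * fps_X) ^ g)"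

  have "fps_nth P n = (\<Sum>X\<in>multisets_of_size {z. z ^ m = 1} n.
          \<Prod>z | z ^ m = 1. fps_nth (F (z ^ t)) (count X z))"
    unfolding P_def by (rule fps_prod_nth'[OF fin])
  also have "\<dots> = (\<Sum>X\<in>multisets_of_size {z. z ^ m = 1} n. y ^ card (set_mset X) * prod_mset X ^ t)"
  proof (rule sum.cong[OF refl])
    fix X assume "X \<in> multisets_of_size {z :: complex. z ^ m = 1} n"
    hence sub: "set_mset X \<subseteq> {z. z ^ m = 1}"
      by (rule multisets_of_size_subset)
    \<comment> \<open>Roots of multiplicity 0 contribute the constant coefficient 1 and drop
      out.\<close>
    have "(\<Prod>z | z ^ m = 1. fps_nth (F (z ^ t)) (count X z)) =
          (\<Prod>z\<in>set_mset X. y * (z ^ count X z) ^ t)"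
      using fin sub
      by (intro prod.mono_neutral_cong_right)
         (auto simp: F_def count_eq_zero_iff power_mult [symmetric] mult.commute)
    also have "\<dots> = y ^ card (set_mset X) * prod_mset X ^ t"
      by (simp add: prod.distrib prod_mset_multiplicity prod_power_distrib)
    finally show "(\<Prod>z | z ^ m = 1. fps_nth (F (z ^ t)) (count X z)) =
          y ^ card (set_mset X) * prod_mset X ^ t" .
  qed
  finally have P_nth: "fps_nth P n = \<dots>" .

  have roots: "(\<Prod>z | z ^ m = 1. 1 - fps_const (u * z ^ t) * fps_X) =
               (1 - fps_const (u ^ d) * fps_X ^ d) ^ g" for u :: complex
    using prod_roots_unity_power[OF \<open>m > 0\<close> g, of "\<lambda>z. 1 - fps_const (u * z) * fps_X"]
    by (simp add: fps_prod_one_minus_roots_unity \<open>d > 0\<close> flip: d)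
  have "(1 - fps_X ^ d) ^ g * P = (\<Prod>z | z ^ m = 1. (1 - fps_const (z ^ t) * fps_X) * F (z ^ t))"
    using roots[of 1] by (simp add: P_def prod.distrib)
  also have "\<dots> = (1 - fps_const v * fps_X ^ d) ^ g"
    using roots[of "1 - y"] by (simp add: F_def v_def fps_one_minus_mult_marked_geometric)
  also have "\<dots> = (1 - fps_const v * fps_X) ^ g oo fps_X ^ d"
    using \<open>d > 0\<close>
    by (simp add: fps_compose_sub_distrib fps_compose_mult_distrib flip: fps_compose_power)
  also have "(1 - fps_const v * fps_X) ^ g = (1 - fps_X) ^ g * Q"
    unfolding Q_def by (simp add: mult.left_commute inverse_mult_eq_1')
  also have "\<dots> oo fps_X ^ d = (1 - fps_X ^ d) ^ g * (Q oo fps_X ^ d)"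
    using \<open>d > 0\<close>
    by (simp add: fps_compose_sub_distrib fps_compose_mult_distrib flip: fps_compose_power)
  finally have "P = Q oo fps_X ^ d"
  proof -
    assume eq: "(1 - fps_X ^ d) ^ g * P = (1 - fps_X ^ d) ^ g * (Q oo fps_X ^ d)"
    \<comment> \<open>The constant coefficient shows that the common factor is nonzero and may be
      cancelled.\<close>
    have "fps_nth (1 - fps_X ^ d :: complex fps) 0 = 1"
      using \<open>d > 0\<close> by simp
    hence "(1 - fps_X ^ d :: complex fps) \<noteq> 0" by force
    with eq show ?thesis by simp
  qed
  hence "fps_nth P n = (if d dvd n then fps_nth Q (n div d) else 0)"
    by (simp add: fps_nth_compose_X_power)
  moreover have "fps_nth Q N = (\<Sum>j\<le>N. of_nat (g choose j) * (- 1) ^ j * (1 - y) ^ (d * j) *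
       of_nat ((g + (N - j) - 1) choose (N - j)))" for N
    unfolding Q_def one_minus_const_fps_X_neg_power'[OF \<open>g > 0\<close>] fps_mult_nth
    by (simp add: fps_nth_one_minus_power atLeast0AtMost v_def power_mult power_minus[of "_ ^ d"] mult.assoc)
  ultimately show ?thesis using P_nth by simp
qed

section \<open>Averaging over characters and extracting coefficients\<close>

lemma sum_powers_root_unity:
  fixes z :: complex
  assumes "z ^ m = 1" "m > 0"
  shows "(\<Sum>t\<in>{0<..m}. z ^ t) = (if z = 1 then of_nat m else 0)"
proof -
  have "(\<Sum>t\<in>{0<..m}. z ^ t) = (\<Sum>t<m. z ^ Suc t)"
    by (rule sum.reindex_bij_witness[of _ Suc "\<lambda>t. t - 1"]) auto
  also have "\<dots> = z * (\<Sum>t<m. z ^ t)"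
    by (simp add: sum_distrib_left)
  finally show ?thesis using assms by (auto simp: geometric_sum)
qed


text \<open>Group the \<open>t\<close> by \<open>g = gcd t m\<close>, a value taken
  \<open>totient (m div g)\<close> times, and pass to the complementary divisor. In the range
  \<open>{0<..m}\<close>, which is that of \<open>card_gcd_eq_totient\<close>, the trivial character
  is represented by \<open>m\<close> instead of 0.\<close>

lemma sum_gcd_eq_sum_totient:
  fixes f :: "nat \<Rightarrow> 'a :: semiring_1"
  assumes "m > 0"
  shows "(\<Sum>t\<in>{0<..m}. f (gcd t m)) = (\<Sum>d | d dvd m. of_nat (totient d) * f (m div d))"
proof -
  have "(\<Sum>t\<in>{0<..m}. f (gcd t m)) = (\<Sum>g | g dvd m. \<Sum>t | t \<in> {0<..m} \<and> gcd t m = g. f (gcd t m))"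
    using assms by (intro sum.group [symmetric]) auto
  also have "\<dots> = (\<Sum>g | g dvd m. of_nat (totient (m div g)) * f g)"
    using assms by (intro sum.cong) (auto simp: card_gcd_eq_totient simp flip: card_gcd_eq_totient)
  also have "\<dots> = (\<Sum>d | d dvd m. of_nat (totient d) * f (m div d))"
    using assms by (intro sum.reindex_bij_witness[of _ "\<lambda>d. m div d" "\<lambda>d. m div d"]) auto
  finally show ?thesis .
qed

definition root_multisets :: "nat \<Rightarrow> nat \<Rightarrow> complex multiset set" where
  "root_multisets n m = {X \<in> multisets_of_size {z. z ^ m = 1} n. prod_mset X = 1}"

lemma finite_root_multisets:
  assumes "m > 0"
  shows "finite (root_multisets n m)"
  unfolding root_multisets_def
  using finite_roots_unity[of m] assms by (auto intro: finite_subset[OF _ finite_multisets_of_size])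

lemma sum_root_multisets:
  fixes y :: complex
  assumes "m > 0"
  shows "of_nat m * (\<Sum>X\<in>root_multisets n m. y ^ card (set_mset X)) =
    (\<Sum>d | d dvd gcd n m. of_nat (totient d) *
       (\<Sum>j\<le>n div d. of_nat (m div d choose j) * (- 1) ^ j * (1 - y) ^ (d * j) *
          of_nat ((m div d + (n div d - j) - 1) choose (n div d - j))))"
    (is "_ = (\<Sum>d | _. _ * ?f d)")
proof -
  define M where "M = multisets_of_size {z :: complex. z ^ m = 1} n"
  have fin: "finite M"
    unfolding M_def using assms by (intro finite_multisets_of_size finite_roots_unity) auto
  \<comment> \<open>The value of \<open>sum_multisets_roots_unity\<close> depends on
    \<open>t\<close> only through \<open>gcd t m\<close>; \<open>h\<close> expresses it in that
    variable.\<close>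
  define h where "h g = (if m div g dvd n then
      \<Sum>j\<le>n div (m div g). of_nat (g choose j) * (- 1) ^ j * (1 - y) ^ (m div g * j) *
       of_nat ((g + (n div (m div g) - j) - 1) choose (n div (m div g) - j)) else 0)" for g
  have "of_nat m * (\<Sum>X\<in>root_multisets n m. y ^ card (set_mset X)) =
        (\<Sum>X\<in>M. if prod_mset X = 1 then of_nat m * y ^ card (set_mset X) else 0)"
    using fin by (simp add: root_multisets_def M_def sum.inter_filter sum_distrib_left if_distrib cong: if_cong)
  also have "\<dots> = (\<Sum>X\<in>M. \<Sum>t\<in>{0<..m}. y ^ card (set_mset X) * prod_mset X ^ t)"
  proof (rule sum.cong[OF refl])
    fix X assume "X \<in> M"
    hence "set_mset X \<subseteq> {z. z ^ m = 1}"
      by (simp add: M_def multisets_of_size_def)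
    \<comment> \<open>The product is again an \<open>m\<close>-th root of unity, so the sum of its
      powers over \<open>t\<close> tests whether it is 1.\<close>
    hence "prod_mset X ^ m = 1"
      by (induction X) (auto simp: power_mult_distrib)
    from sum_powers_root_unity[OF this assms]
    show "(if prod_mset X = 1 then of_nat m * y ^ card (set_mset X) else 0) =
          (\<Sum>t\<in>{0<..m}. y ^ card (set_mset X) * prod_mset X ^ t)"
      by (simp flip: sum_distrib_left)
  qed
  also have "\<dots> = (\<Sum>t\<in>{0<..m}. \<Sum>X\<in>M. y ^ card (set_mset X) * prod_mset X ^ t)"
    by (rule sum.swap)
  also have "\<dots> = (\<Sum>t\<in>{0<..m}. h (gcd t m))"
    unfolding M_def h_def using sum_multisets_roots_unity[OF assms refl refl] by (intro sum.cong refl)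
  also have "\<dots> = (\<Sum>d | d dvd m. of_nat (totient d) * (if d dvd n then ?f d else 0))"
    unfolding sum_gcd_eq_sum_totient[OF assms, of h] unfolding h_def using assms by (intro sum.cong) auto
  also have "\<dots> = (\<Sum>d | d dvd gcd n m. of_nat (totient d) * ?f d)"
    using assms by (intro sum.mono_neutral_cong_right) auto
  finally show ?thesis .
qed

lemma coeff_one_minus_power:
  "poly.coeff ([:1, - 1 :: 'a :: comm_ring_1:] ^ k) s = of_nat (k choose s) * (- 1) ^ s"
proof -
  have "[:1, - 1 :: 'a:] ^ k = (Polynomial.monom (- 1) 1 + 1) ^ k"
    by (simp add: monom_altdef one_pCons)
  also have "\<dots> = (\<Sum>i\<le>k. Polynomial.monom (of_nat (k choose i) * (- 1) ^ i) i)"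
    unfolding binomial_ring
    by (intro sum.cong refl) (simp add: monom_power of_nat_poly smult_monom)
  finally show ?thesis
    by (simp add: coeff_sum binomial_eq_0)
qed

text \<open>The identity of \<open>sum_root_multisets\<close> holds for all complex
  \<open>y\<close>, so both sides agree as polynomials in \<open>y\<close>, and the coefficients at
  \<open>y^s\<close> are compared. The factor \<open>(1 - y)^(d j)\<close> yields the last binomial
  coefficient and the sign \<open>(-1)^s\<close>.\<close>

lemma card_root_multisets:
  assumes "m > 0"
  shows "real m * real (card {X \<in> root_multisets n m. card (set_mset X) = s}) =
    (\<Sum>d | d dvd gcd n m. real (totient d) *
       (\<Sum>j\<le>n div d. real (m div d choose j) * (- 1) ^ (j + s) * real (d * j choose s) *
          real ((m div d + (n div d - j) - 1) choose (n div d - j))))"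
proof -
  define p :: "complex poly" where
    "p = (\<Sum>X\<in>root_multisets n m. Polynomial.monom (of_nat m) (card (set_mset X)))"
  define q :: "complex poly" where
    "q = (\<Sum>d | d dvd gcd n m. Polynomial.smult (of_nat (totient d))
       (\<Sum>j\<le>n div d. Polynomial.smult (of_nat (m div d choose j) * (- 1) ^ j *
          of_nat ((m div d + (n div d - j) - 1) choose (n div d - j))) ([:1, -1:] ^ (d * j))))"
  have "poly p y = poly q y" for y
    using sum_root_multisets[OF assms, where n = n and y = y]
    by (simp add: p_def q_def poly_sum poly_monom sum_distrib_left mult_ac)
  hence "p = q" by (simp add: poly_eq_poly_eq_iff [symmetric] fun_eq_iff)
  hence "poly.coeff p s = poly.coeff q s" by simp
  also have "poly.coeff p s = of_real (real m * real (card {X \<in> root_multisets n m. card (set_mset X) = s}))"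
    using finite_root_multisets[OF assms, of n]
    by (simp add: p_def coeff_sum if_distrib sum.inter_filter [symmetric] cong: if_cong)
  also have "poly.coeff q s = of_real (\<Sum>d | d dvd gcd n m. real (totient d) *
       (\<Sum>j\<le>n div d. real (m div d choose j) * (- 1) ^ (j + s) * real (d * j choose s) *
          real ((m div d + (n div d - j) - 1) choose (n div d - j))))"
    by (simp add: q_def coeff_sum coeff_one_minus_power power_add mult_ac)
  finally show ?thesis unfolding of_real_eq_iff .
qed

section \<open>Classes and multisets\<close>

lemma spectrum_eq_set:
  fixes A :: "'a :: field mat"
  assumes "A \<in> carrier_mat n n" "char_poly A = (\<Prod>e\<leftarrow>es. [:- e, 1:])"
  shows "spectrum A = set es"
proof -
  have "(\<Prod>e\<leftarrow>es. [:- e, 1:]) \<noteq> 0"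
    by (auto simp: prod_list_zero_iff)
  hence "{k. poly (char_poly A) k = 0} = set_mset (proots (\<Prod>e\<leftarrow>es. [:- e, 1:]))"
    by (simp add: assms(2))
  thus ?thesis
    by (simp add: spectrum_root_char_poly[OF assms(1)] proots_prod_linear)
qed

text \<open>Conjugation commutes with powers and preserves the characteristic polynomial, so both
  conditions may be tested at a single representative.\<close>

lemma conj_class_in_SU_classes_iff:
  assumes x: "x \<in> carrier (SU n)"
  shows "conj_class (SU n) x \<in> SU_classes n m s \<longleftrightarrow>
    x [^]\<^bsub>SU n\<^esub> m = \<one>\<^bsub>SU n\<^esub> \<and> card (spectrum x) = s"
proof
  assume "conj_class (SU n) x \<in> SU_classes n m s"
  with conj_class_refl[OF group_SU x]
  show "x [^]\<^bsub>SU n\<^esub> m = \<one>\<^bsub>SU n\<^esub> \<and> card (spectrum x) = s"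
    unfolding SU_classes_def by blast
next
  interpret group "SU n" by (rule group_SU)
  assume *: "x [^]\<^bsub>SU n\<^esub> m = \<one>\<^bsub>SU n\<^esub> \<and> card (spectrum x) = s"
  have "y [^]\<^bsub>SU n\<^esub> m = \<one>\<^bsub>SU n\<^esub> \<and> card (spectrum y) = s"
    if y: "y \<in> conj_class (SU n) x" for y
  proof
    obtain g where g: "g \<in> carrier (SU n)" "y = g \<otimes>\<^bsub>SU n\<^esub> x \<otimes>\<^bsub>SU n\<^esub> inv\<^bsub>SU n\<^esub> g"
      using y by (auto simp: conj_class_def)
    show "y [^]\<^bsub>SU n\<^esub> m = \<one>\<^bsub>SU n\<^esub>"
      unfolding g(2) pow_conjugate[OF group_SU g(1) x] conjunct1[OF *] using g(1)
      by (simp del: SU_simps)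
    have "y \<in> carrier (SU n)"
      unfolding g(2) using g(1) x by (simp del: SU_simps)
    hence "spectrum y = spectrum x"
      using x char_poly_conj_class_SU[OF x y] by (simp add: spectrum_root_char_poly[of _ n])
    with * show "card (spectrum y) = s" by simp
  qed
  thus "conj_class (SU n) x \<in> SU_classes n m s"
    using x unfolding SU_classes_def conjugacy_classes_eq by blast
qed

lemma cnj_mult_self_root_unity:
  assumes "z ^ m = 1" "m > 0"
  shows "cnj z * z = 1"
proof -
  have "norm z = 1" using power_eq_1_iff[OF assms(1)] assms(2) by simp
  thus ?thesis by (simp add: complex_norm_square[symmetric] mult.commute)
qed

text \<open>Any ordering of a multiset gives a diagonal matrix. The characteristic polynomial
  recovers the multiset from the class, and diagonalisation with the diagonal in the chosen order
  shows that every class is reached.\<close>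

lemma bij_betw_SU_classes:
  assumes "n > 0" "m > 0"
  shows "bij_betw (\<lambda>X. conj_class (SU n) (diag_list (SOME xs. mset xs = X)))
    {X \<in> root_multisets n m. card (set_mset X) = s} (SU_classes n m s)"
proof -
  define l where "l X = (SOME xs :: complex list. mset xs = X)" for X
  define W where "W = {X \<in> root_multisets n m. card (set_mset X) = s}"
  have l [simp]: "mset (l X) = X" for X
    unfolding l_def by (rule someI_ex) (rule ex_mset)
  have set_l [simp]: "set (l X) = set_mset X" for X
    by (metis l set_mset_mset)
  have len: "length (l X) = size X" for X
    by (metis l size_mset)
  have prod_l: "prod_list (l X) = prod_mset X" for X
    by (metis l prod_mset_prod_list)
  have diag: "diag_list (l X) \<in> carrier (SU n)" if "X \<in> W" for X
  proof -
    have X: "set_mset X \<subseteq> {z. z ^ m = 1}" "size X = n" "prod_mset X = 1"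
      using that by (auto simp: W_def root_multisets_def multisets_of_size_def)
    hence "diag_list (l X) \<in> carrier (SU (length (l X)))"
      using cnj_mult_self_root_unity[OF _ assms(2)]
      by (intro diag_list_in_SU) (auto simp: prod_l)
    with X show ?thesis by (simp only: len)
  qed
  have mem: "conj_class (SU n) (diag_list (l X)) \<in> SU_classes n m s" if "X \<in> W" for X
  proof -
    have X: "set_mset X \<subseteq> {z. z ^ m = 1}" "size X = n" "card (set_mset X) = s"
      using that by (auto simp: W_def root_multisets_def multisets_of_size_def)
    have "spectrum (diag_list (l X)) = set_mset X"
      using spectrum_eq_set[OF diag_list_carrier char_poly_diag_list, of "l X"] by simp
    with X show ?thesis
      using pow_diag_list_SU_eq_one_iff[of "l X" m]
      by (subst conj_class_in_SU_classes_iff[OF diag[OF that]]) (auto simp: len)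
  qed
  have "inj_on (\<lambda>X. conj_class (SU n) (diag_list (l X))) W"
  proof (rule inj_onI)
    fix X Y assume XY: "X \<in> W" "Y \<in> W"
      "conj_class (SU n) (diag_list (l X)) = conj_class (SU n) (diag_list (l Y))"
    have "char_poly (diag_list (l Y)) = char_poly (diag_list (l X))"
      using char_poly_conj_class_SU[OF diag[OF XY(1)]] conj_class_refl[OF group_SU diag[OF XY(2)]] XY(3)
      by simp
    from arg_cong[OF this, of proots] show "X = Y"
      by (simp add: char_poly_diag_list proots_prod_linear)
  qed
  moreover have "C \<in> (\<lambda>X. conj_class (SU n) (diag_list (l X))) ` W" if C: "C \<in> SU_classes n m s" for C
  proof -
    interpret group "SU n" by (rule group_SU)
    obtain x where x: "x \<in> carrier (SU n)" "C = conj_class (SU n) x"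
      using C by (auto simp: SU_classes_def conjugacy_classes_eq)
    hence pow: "x [^]\<^bsub>SU n\<^esub> m = \<one>\<^bsub>SU n\<^esub>" and card: "card (spectrum x) = s"
      using C conj_class_in_SU_classes_iff by auto
    have xc: "x \<in> carrier_mat n n" using x(1) by simp
    from char_poly_factorized[OF xc]
    obtain es where es: "char_poly x = (\<Prod>e\<leftarrow>es. [:- e, 1:])" "length es = n" by blast
    define X where "X = mset es"
    \<comment> \<open>\<open>es\<close> and \<open>l X\<close> may order the eigenvalues
      differently, but the product of the linear factors depends only on the multiset.\<close>
    have "mset (map (\<lambda>e. [:- e, 1:]) (l X)) = mset (map (\<lambda>e. [:- e, 1:]) es)"
      by (simp only: mset_map l) (simp add: X_def)
    hence cp: "char_poly x = (\<Prod>e\<leftarrow>l X. [:- e, 1:])"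
      unfolding es(1) by (simp only: prod_mset_prod_list [symmetric])
    have size: "size X = n" by (simp add: X_def es(2))
    obtain g where g: "g \<in> carrier (SU n)"
      "x = g \<otimes>\<^bsub>SU n\<^esub> diag_list (l X) \<otimes>\<^bsub>SU n\<^esub> inv\<^bsub>SU n\<^esub> g"
      using conjugate_diag_list_SU[OF x(1) assms(1) cp] by blast
    have g': "g \<in> carrier_mat n n" "unitary_mat g" "det g = 1"
      using g(1) by auto
    have D: "diag_list (l X) \<in> carrier_mat n n"
      using diag_list_carrier[of "l X"] by (simp add: len size)
    \<comment> \<open>Solving for the diagonal matrix exhibits it as a conjugate of
      \<open>x\<close>, so it inherits membership in \<open>SU n\<close> and the equation for the
      \<open>m\<close>-th power.\<close>
    have "mat_adjoint g * x * g = mat_adjoint g * (g * (diag_list (l X) * (mat_adjoint g * g)))"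
      using g' D by (subst g(2)) (simp add: inv_SU[OF g(1)] assoc_mult_mat[of _ n n _ n _ n]
        mult_carrier_mat[of _ n n _ n])
    also have "\<dots> = diag_list (l X)"
      using g' D by (simp add: unitary_matD mult_assoc_cancel[of _ n])
    finally have Dx: "diag_list (l X) = inv\<^bsub>SU n\<^esub> g \<otimes>\<^bsub>SU n\<^esub> x \<otimes>\<^bsub>SU n\<^esub> inv\<^bsub>SU n\<^esub> (inv\<^bsub>SU n\<^esub> g)"
      using inv_inv[OF g(1)] by (simp add: inv_SU[OF g(1)])
    have DSU: "diag_list (l X) \<in> carrier (SU n)"
      unfolding Dx using g(1) x(1) by (simp del: SU_simps)
    have "diag_list (l X) [^]\<^bsub>SU n\<^esub> m = \<one>\<^bsub>SU n\<^esub>"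
      unfolding Dx pow_conjugate[OF group_SU inv_closed[OF g(1)] x(1)] pow
      using g(1) by (simp del: SU_simps)
    hence "\<forall>z \<in># X. z ^ m = 1"
      using pow_diag_list_SU_eq_one_iff[of "l X" m] by (simp add: len size)
    moreover have "prod_mset X = 1"
      using DSU det_diag_list[of "l X"] by (simp add: prod_l)
    moreover have "card (set_mset X) = s"
      using card spectrum_eq_set[OF xc cp] by simp
    ultimately have "X \<in> W"
      using size by (auto simp: W_def root_multisets_def multisets_of_size_def)
    moreover have "x \<in> conj_class (SU n) (diag_list (l X))"
      using g by (auto simp: conj_class_def)
    hence "C = conj_class (SU n) (diag_list (l X))"
      using conj_class_eqI[OF group_SU DSU x(1)] x(2) by simp
    ultimately show ?thesis by blast
  qed
  ultimately have "bij_betw (\<lambda>X. conj_class (SU n) (diag_list (l X))) W (SU_classes n m s)"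
    by (intro bij_betw_imageI equalityI image_subsetI subsetI mem)
  thus ?thesis by (simp only: W_def l_def)
qed

section \<open>Passage to the stated series\<close>

lemma suminf_eq_sum_atMost:
  fixes f :: "nat \<Rightarrow> 'a :: {t2_space, comm_monoid_add}"
  assumes "\<And>j. j > N \<Longrightarrow> f j = 0"
  shows "(\<Sum>j. f j) = (\<Sum>j\<le>N. f j)"
  using assms by (intro suminf_finite) auto

text \<open>For \<open>j \<le> N\<close> the lower index is nonnegative, and \<open>M > 0\<close>
  both bounds it by the upper index and makes the truncated subtraction of 1 exact.\<close>

lemma int_binomial_eq:
  assumes "j \<le> N" "M > 0"
  shows "int_binomial (int N + int M - int j - 1) (int N - int j) = (M + (N - j) - 1) choose (N - j)"
proof -
  have "nat (int N + int M - int j - 1) = M + (N - j) - 1" "nat (int N - int j) = N - j"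
    using assms by auto
  thus ?thesis using assms by (auto simp: int_binomial_def)
qed

theorem theorem5:
  fixes n m s :: nat
  assumes "n > 0" and "m > 0" and "s > 0"
  shows "finite (SU_classes n m s) \<and>
    real (N_SU n m s) =
      1 / real m * (\<Sum>d | d dvd gcd n m. \<Sum>j.
        real (totient d)
        * real (int_binomial (int (n div d) + int (m div d) - int j - 1) (int (n div d) - int j))
        * real ((m div d) choose j) * real ((j * d) choose s) * (-1) ^ (j + s))"
proof -
  define W where "W = {X \<in> root_multisets n m. card (set_mset X) = s}"
  note bij = bij_betw_SU_classes[OF assms(1,2), of s, folded W_def]
  have "finite W"
    using finite_root_multisets[OF assms(2)] by (simp add: W_def)
  hence fin: "finite (SU_classes n m s)"
    using bij_betw_finite[OF bij] by simp
  have "real m * real (N_SU n m s) = real m * real (card W)"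
    using bij_betw_same_card[OF bij] by (simp add: N_SU_def)
  also have "\<dots> = (\<Sum>d | d dvd gcd n m. \<Sum>j.
        real (totient d)
        * real (int_binomial (int (n div d) + int (m div d) - int j - 1) (int (n div d) - int j))
        * real ((m div d) choose j) * real ((j * d) choose s) * (-1) ^ (j + s))"
    unfolding W_def card_root_multisets[OF assms(2)]
  proof (rule sum.cong[OF refl])
    fix d assume "d \<in> {d. d dvd gcd n m}"
    hence "m div d > 0"
      using assms(2) by (auto simp: div_greater_zero_iff dvd_imp_le intro: dvd_pos_nat)
    let ?t = "\<lambda>j. real (totient d)
        * real (int_binomial (int (n div d) + int (m div d) - int j - 1) (int (n div d) - int j))
        * real ((m div d) choose j) * real ((j * d) choose s) * (-1) ^ (j + s)"
    \<comment> \<open>For \<open>j > n div d\<close> the lower index of \<open>int_binomial\<close>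
      is negative and the term vanishes, so the series is a finite sum.\<close>
    have "(\<Sum>j. ?t j) = (\<Sum>j\<le>n div d. ?t j)"
      by (rule suminf_eq_sum_atMost) (simp add: int_binomial_def)
    also have "\<dots> = (\<Sum>j\<le>n div d. real (totient d) *
        (real (m div d choose j) * (- 1) ^ (j + s) * real (d * j choose s) *
          real ((m div d + (n div d - j) - 1) choose (n div d - j))))"
      by (rule sum.cong[OF refl])
         (simp only: atMost_iff int_binomial_eq[OF _ \<open>m div d > 0\<close>] mult_ac)
    finally show "real (totient d) *
       (\<Sum>j\<le>n div d. real (m div d choose j) * (- 1) ^ (j + s) * real (d * j choose s) *
          real ((m div d + (n div d - j) - 1) choose (n div d - j))) = (\<Sum>j. ?t j)"
      by (simp only: sum_distrib_left)
  qed
  finally show ?thesis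
    using fin assms(2) by (simp add: field_simps)
qed

end
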